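(* Let $\mathcal{M}$ be a countable set of sequences that contains every periodic sequence. Then there is no algorithm which, given (as oracles) a generalized almost periodic sequence $x$ and a function $f\colon\mathbb{N}\to\mathbb{N}$ with $f(n)\geqslant r_x(n)$ for all $n$, decides whether $x\in\mathcal{M}$.
   Context: Sequences are maps $x\colon\mathbb{N}\to A$ over finite alphabets. $x$ is periodic if there is $T\geqslant1$ with $x(i)=x(i+T)$ for all $i$. $x$ is generalized almost periodic if for every finite word $u$ occurring in $x$ infinitely many times there is $l$ such that every segment $x(i)\dots x(i+l-1)$ contains $u$. Its regulator $r_x(n)$ is the least $l$ such that every length-$n$ word occurring infinitely often in $x$ occurs in every length-$l$ segment of $x$, and every length-$n$ word occurring only finitely often does not occur in $x(l)x(l+1)\dots$. The algorithm has oracle access to the values of $x$ and $f$ and must halt with the correct answer on every admissible input pair $(x,f)$. *)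

theory Defs
  imports Main "HOL-Library.Countable_Set" "HOL-Library.Sublist"
begin

text \<open>
  Letters are natural numbers, and a sequence is a map into some finite alphabet \<open>B\<close>. The
  parameter \<open>A\<close> is the supply of letters from which alphabets are taken: for finite \<open>A\<close>, the
  set \<open>sequences A\<close> is the set of all maps into the fixed alphabet \<open>A\<close>, whereas
  \<open>sequences UNIV\<close> contains the sequences over all finite alphabets at once.
\<close>

definition sequences :: "nat set \<Rightarrow> (nat \<Rightarrow> nat) set" where
  "sequences A = {x. \<exists>B. finite B \<and> B \<subseteq> A \<and> (\<forall>i. x i \<in> B)}"

definition periodic :: "(nat \<Rightarrow> 'a) \<Rightarrow> bool" where
  "periodic x \<longleftrightarrow> (\<exists>T\<ge>1. \<forall>i. x i = x (i + T))"

definition segment :: "(nat \<Rightarrow> 'a) \<Rightarrow> nat \<Rightarrow> nat \<Rightarrow> 'a list" where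
  "segment x i l = map x [i..<i + l]"

definition occurrences :: "'a list \<Rightarrow> (nat \<Rightarrow> 'a) \<Rightarrow> nat set" where
  "occurrences u x = {i. segment x i (length u) = u}"

definition generalized_almost_periodic :: "(nat \<Rightarrow> 'a) \<Rightarrow> bool" where
  "generalized_almost_periodic x \<longleftrightarrow>
     (\<forall>u. infinite (occurrences u x) \<longrightarrow> (\<exists>l. \<forall>i. sublist u (segment x i l)))"

text \<open>
  For a generalized almost periodic \<open>x\<close> with finite range the \<open>LEAST\<close> below is attained,
  since only finitely many words of length \<open>n\<close> occur in \<open>x\<close>.
\<close>

definition regulator :: "(nat \<Rightarrow> 'a) \<Rightarrow> nat \<Rightarrow> nat" where
  "regulator x n = (LEAST l. \<forall>u. length u = n \<longrightarrow>
     (infinite (occurrences u x) \<longrightarrow> (\<forall>i. sublist u (segment x i l))) \<and>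
     (finite (occurrences u x) \<longrightarrow> (\<forall>i\<ge>l. i \<notin> occurrences u x)))"

text \<open>
  Algorithms with two oracles are Kleene's partial recursive functionals: the partial recursive
  functions with the two oracles added to the initial functions. \<open>computes x f p xs v\<close> says that
  the program \<open>p\<close> with oracles \<open>x\<close> and \<open>f\<close> halts on the arguments \<open>xs\<close> with output \<open>v\<close>; a program
  that does not halt has no output. \<open>Zero\<close> and \<open>Proj i\<close> accept any sufficiently long argument list.
\<close>

datatype oracle_program =
    Zero
  | Succ
  | Proj nat
  | OracleX
  | OracleF
  | Comp oracle_program "oracle_program list"
  | PrimRec oracle_program oracle_program
  | Mu oracle_program

inductive computes ::
  "(nat \<Rightarrow> nat) \<Rightarrow> (nat \<Rightarrow> nat) \<Rightarrow> oracle_program \<Rightarrow> nat list \<Rightarrow> nat \<Rightarrow> bool"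
  for x f :: "nat \<Rightarrow> nat" where
  zero: "computes x f Zero xs 0"
| succ: "computes x f Succ [a] (Suc a)"
| proj: "i < length xs \<Longrightarrow> computes x f (Proj i) xs (xs ! i)"
| oracle_x: "computes x f OracleX [a] (x a)"
| oracle_f: "computes x f OracleF [a] (f a)"
| comp: "list_all2 (\<lambda>q b. computes x f q xs b) qs bs \<Longrightarrow> computes x f p bs v \<Longrightarrow>
    computes x f (Comp p qs) xs v"
| primrec_0: "computes x f p xs v \<Longrightarrow> computes x f (PrimRec p q) (0 # xs) v"
| primrec_Suc: "computes x f (PrimRec p q) (n # xs) w \<Longrightarrow> computes x f q (n # w # xs) v \<Longrightarrow>
    computes x f (PrimRec p q) (Suc n # xs) v"
| mu: "computes x f p (n # xs) 0 \<Longrightarrow> (\<forall>m<n. \<exists>v>0. computes x f p (m # xs) v) \<Longrightarrow>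
    computes x f (Mu p) xs n"

inductive_cases computesE:
  "computes x f Zero xs v" "computes x f Succ xs v" "computes x f (Proj i) xs v"
  "computes x f OracleX xs v" "computes x f OracleF xs v" "computes x f (Comp p qs) xs v"
  "computes x f (Mu p) xs v"
inductive_cases computes_PrimRec_0E: "computes x f (PrimRec p q) (0 # xs) v"
inductive_cases computes_PrimRec_SucE: "computes x f (PrimRec p q) (Suc n # xs) v"

lemma computes_deterministic:
  "computes x f p xs v \<Longrightarrow> computes x f p xs w \<Longrightarrow> v = w"
proof (induction arbitrary: w rule: computes.induct)
  case (comp xs qs bs p v)
  from comp.prems obtain bs' where
    bs': "list_all2 (\<lambda>q b. computes x f q xs b) qs bs'" "computes x f p bs' w"
    by (rule computesE(6))
  have "bs = bs'"
    using comp.IH(1) bs'(1) by (auto simp: list_all2_conv_all_nth intro!: nth_equalityI)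
  then show ?case using comp.IH(2) bs'(2) by blast
next
  case (primrec_0 p xs v q)
  from primrec_0.prems show ?case
    by (rule computes_PrimRec_0E) (rule primrec_0.IH)
next
  case (primrec_Suc p q n xs u v)
  from primrec_Suc.prems obtain u' where
    u': "computes x f (PrimRec p q) (n # xs) u'" "computes x f q (n # u' # xs) w"
    by (rule computes_PrimRec_SucE)
  then show ?case using primrec_Suc.IH by blast
next
  case (mu p n xs)
  from mu.prems have w: "computes x f p (w # xs) 0" "\<forall>m<w. \<exists>v>0. computes x f p (m # xs) v"
    by (rule computesE(7), simp)+
  have "\<not> n < w" using w(2) mu.IH(1) by blast
  moreover have "\<not> w < n" using w(1) mu.IH(2) by blast
  ultimately show ?case by simp
qed (erule computesE; simp)+

text \<open>
  The program gets no numerical input; it must answer \<open>1\<close> (yes) or \<open>0\<close> (no), and nothing is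
  required of it on inadmissible oracles.
\<close>

definition decides_membership ::
  "nat set \<Rightarrow> oracle_program \<Rightarrow> (nat \<Rightarrow> nat) set \<Rightarrow> bool" where
  "decides_membership A p M \<longleftrightarrow>
     (\<forall>x\<in>sequences A. \<forall>f :: nat \<Rightarrow> nat.
        generalized_almost_periodic x \<longrightarrow> (\<forall>n. f n \<ge> regulator x n) \<longrightarrow>
        computes x f p [] (if x \<in> M then 1 else 0))"

end

theory Submission imports Defs begin

text \<open>
  A halting computation reads only finitely many oracle values, so it suffices to find an
  admissible input \<open>(x, f)\<close> with \<open>x\<close> outside \<open>M\<close> that is a limit of admissible inputs with
  periodic \<open>x\<close>. A Toeplitz sequence \<open>x\<close> over two letters with an arbitrary bound \<open>f\<close> on its
  recurrence has this property: cutting \<open>x\<close> at a common period greater than \<open>N\<close> of its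
  first \<open>N\<close> places and repeating the piece gives a periodic sequence all of whose words of length at most \<open>N\<close> occur
  in \<open>x\<close>, so that \<open>f\<close> still bounds the first values of its regulator. As there are uncountably
  many such sequences, one of them avoids the countable set \<open>M\<close>; it is found by diagonalization.
\<close>

section \<open>Continuity of computations in their oracles\<close>

text \<open>A derivation of \<open>computes\<close> is a finite tree whose oracle leaves each read
  one value, so some \<open>N\<close> lies above all places read; the induction assembles it from
  the subderivations.\<close>

lemma computes_continuous:
  assumes "computes x f p xs v"
  shows "\<exists>N. \<forall>y g. (\<forall>i<N. y i = x i \<and> g i = f i) \<longrightarrow> computes y g p xs v"
  using assms
proof (induction rule: computes.induct)
  case (oracle_x a)
  show ?case by (rule exI[of _ "Suc a"]) (metis computes.oracle_x lessI)
next
  case (oracle_f a)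
  show ?case by (rule exI[of _ "Suc a"]) (metis computes.oracle_f lessI)
next
  case (comp xs qs bs p v)
  have len: "length qs = length bs" using comp.IH(1) by (rule list_all2_lengthD)
  have "\<forall>k\<in>{..<length qs}. \<exists>N. \<forall>y g. (\<forall>i<N. y i = x i \<and> g i = f i) \<longrightarrow>
      computes y g (qs ! k) xs (bs ! k)"
    using comp.IH(1) by (auto simp: list_all2_conv_all_nth)
  then obtain F where F: "\<And>k y g. k < length qs \<Longrightarrow> (\<forall>i<F k. y i = x i \<and> g i = f i) \<Longrightarrow>
      computes y g (qs ! k) xs (bs ! k)"
    unfolding bchoice_iff by (metis lessThan_iff)
  obtain N where N: "\<And>y g. (\<forall>i<N. y i = x i \<and> g i = f i) \<Longrightarrow> computes y g p bs v"
    using comp.IH(2) by blast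
  \<comment> \<open>The sum serves as one number above all the finitely many bounds
    \<open>F k\<close>.\<close>
  have bound: "F k \<le> sum F {..<length qs}" if "k < length qs" for k
    using that by (intro member_le_sum) auto
  show ?case
  proof (intro exI allI impI)
    fix y g assume agree: "\<forall>i<N + sum F {..<length qs}. y i = x i \<and> g i = f i"
    have "computes y g (qs ! k) xs (bs ! k)" if "k < length qs" for k
      using bound[OF that] agree by (intro F that) auto
    moreover have "computes y g p bs v" using agree by (intro N) auto
    ultimately show "computes y g (Comp p qs) xs v"
      using len by (intro computes.comp[of _ _ _ _ bs]) (auto simp: list_all2_conv_all_nth)
  qed
next
  case (primrec_0 p xs v q)
  then show ?case by (metis computes.primrec_0)
next
  case (primrec_Suc p q n xs w v)
  then obtain N1 N2 where
    "\<And>y g. (\<forall>i<N1. y i = x i \<and> g i = f i) \<Longrightarrow> computes y g (PrimRec p q) (n # xs) w"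
    "\<And>y g. (\<forall>i<N2. y i = x i \<and> g i = f i) \<Longrightarrow> computes y g q (n # w # xs) v"
    by blast
  then show ?case
    by (intro exI[of _ "N1 + N2"]) (auto intro: computes.primrec_Suc[of _ _ _ _ _ _ w])
next
  case (mu p n xs)
  have "\<forall>m\<in>{..<n}. \<exists>N. \<exists>v>0. \<forall>y g. (\<forall>i<N. y i = x i \<and> g i = f i) \<longrightarrow>
      computes y g p (m # xs) v"
    using mu.IH(2) by (metis lessThan_iff)
  then obtain F where F: "\<And>m. m < n \<Longrightarrow> \<exists>v>0. \<forall>y g. (\<forall>i<F m. y i = x i \<and> g i = f i) \<longrightarrow>
      computes y g p (m # xs) v"
    unfolding bchoice_iff by (metis lessThan_iff)
  obtain N where N: "\<And>y g. (\<forall>i<N. y i = x i \<and> g i = f i) \<Longrightarrow> computes y g p (n # xs) 0"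
    using mu.IH(1) by blast
  have bound: "F m \<le> sum F {..<n}" if "m < n" for m
    using that by (intro member_le_sum) auto
  show ?case
  proof (intro exI allI impI)
    fix y g assume agree: "\<forall>i<N + sum F {..<n}. y i = x i \<and> g i = f i"
    have "\<exists>v>0. computes y g p (m # xs) v" if "m < n" for m
    proof -
      have "\<forall>i<F m. y i = x i \<and> g i = f i" using bound[OF that] agree by auto
      then show ?thesis using F[OF that] by blast
    qed
    moreover have "computes y g p (n # xs) 0" using agree by (intro N) auto
    ultimately show "computes y g (Mu p) xs n" by (blast intro: computes.mu)
  qed
qed (blast intro: computes.intros)+

section \<open>Occurrences of words and the regulator\<close>

lemma length_segment [simp]: "length (segment x i l) = l"
  by (simp add: segment_def)

lemma segment_eq_iff: "segment x i l = segment y j l \<longleftrightarrow> (\<forall>k<l. x (i + k) = y (j + k))"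
  by (auto simp: segment_def list_eq_iff_nth_eq)

lemma sublist_segment_iff:
  "sublist u (segment x i l) \<longleftrightarrow>
     (\<exists>q\<ge>i. q + length u \<le> i + l \<and> q \<in> occurrences u x)" (is "?L \<longleftrightarrow> ?R")
proof
  assume ?L
  then obtain ps ss where eq: "segment x i l = ps @ u @ ss" by (auto simp: sublist_def)
  have len: "l = length ps + length u + length ss" using arg_cong[OF eq, of length] by simp
  have "u ! k = x (i + length ps + k)" if "k < length u" for k
  proof -
    have "u ! k = segment x i l ! (length ps + k)" using that by (simp add: eq nth_append)
    also have "\<dots> = x (i + length ps + k)" using that len by (simp add: segment_def add.assoc)
    finally show ?thesis .
  qed
  then have "i + length ps \<in> occurrences u x"
    unfolding occurrences_def segment_def by (auto intro: nth_equalityI)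
  moreover have "i \<le> i + length ps" "i + length ps + length u \<le> i + l" using len by simp_all
  ultimately show ?R by blast
next
  assume ?R
  then obtain q where q: "i \<le> q" "q + length u \<le> i + l" "segment x q (length u) = u"
    unfolding occurrences_def by blast
  then have "[i..<i + l] = [i..<q] @ [q..<q + length u] @ [q + length u..<i + l]"
    using upt_add_eq_append[of i q "i + l - q"]
      upt_add_eq_append[of q "q + length u" "i + l - (q + length u)"]
    by simp
  then have "segment x i l = map x [i..<q] @ u @ map x [q + length u..<i + l]"
    using q(3) by (simp add: segment_def)
  then show ?L by (auto simp: sublist_def)
qed

text \<open>A word found in every window occurs arbitrarily far out. Hence words with finitely many
  occurrences have none at all, both clauses of \<open>regulator\<close> hold for \<open>l\<close>,
  and the least value is at most \<open>l\<close>.\<close>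

lemma regulator_le:
  assumes "\<And>u p. length u = n \<Longrightarrow> occurrences u x \<noteq> {} \<Longrightarrow> sublist u (segment x p l)"
  shows "regulator x n \<le> l"
proof -
  have "infinite (occurrences u x)" if "length u = n" "occurrences u x \<noteq> {}" for u
    unfolding infinite_nat_iff_unbounded_le
    using assms[OF that] by (auto simp: sublist_segment_iff)
  then show ?thesis
    unfolding regulator_def by (intro Least_le) (use assms in fastforce)
qed

section \<open>Toeplitz sequences\<close>

text \<open>The period \<open>d\<close> may depend on the position \<open>i\<close>, which admits
  non-periodic sequences.\<close>

definition toeplitz :: "(nat \<Rightarrow> 'a) \<Rightarrow> bool" where
  "toeplitz x \<longleftrightarrow> (\<forall>i. \<exists>d>0. \<forall>m. x (i + m * d) = x i)"

lemma periodic_imp_toeplitz: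
  assumes "periodic x"
  shows "toeplitz x"
proof -
  obtain T where T: "T \<ge> 1" "\<And>i. x i = x (i + T)" using assms by (auto simp: periodic_def)
  have "x (i + m * T) = x i" for i m
  proof (induction m)
    case (Suc m)
    have "x (i + Suc m * T) = x (i + m * T + T)" by (simp add: algebra_simps)
    then show ?case using T(2) Suc by simp
  qed simp
  then show ?thesis using T(1) by (auto simp: toeplitz_def intro!: exI[of _ T])
qed

lemma toeplitz_common_period:
  assumes "toeplitz x"
  shows "\<exists>d>0. \<forall>i<N. \<forall>m. x (i + m * d) = x i"
proof (induction N)
  case (Suc N)
  then obtain d where d: "d > 0" "\<forall>i<N. \<forall>m. x (i + m * d) = x i" by auto
  obtain e where e: "e > 0" "\<forall>m. x (N + m * e) = x N"
    using assms by (auto simp: toeplitz_def)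
  have "x (i + m * (d * e)) = x i" if "i < Suc N" for i m
  proof (cases "i = N")
    case True
    then show ?thesis using e(2)[rule_format, of "m * d"] by (simp add: mult.assoc)
  next
    case False
    then show ?thesis using that d(2)[rule_format, of i "m * e"] by (simp add: ac_simps)
  qed
  then show ?case using d(1) e(1) by (intro exI[of _ "d * e"]) auto
qed auto

text \<open>A common period \<open>d\<close> of the places up to the end of one occurrence moves
  that occurrence to every \<open>i + m * d\<close>, so gaps are bounded.\<close>

lemma toeplitz_word_recurs:
  assumes "toeplitz x" "i \<in> occurrences u x"
  shows "\<exists>l. \<forall>p. sublist u (segment x p l)"
proof -
  obtain d where d: "d > 0" "\<And>j m. j < i + length u \<Longrightarrow> x (j + m * d) = x j"
    using toeplitz_common_period[OF assms(1), of "i + length u"] by blast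
  have occ: "i + m * d \<in> occurrences u x" for m
  proof -
    have "x (i + m * d + k) = x (i + k)" if "k < length u" for k
      using d(2)[of "i + k" m] that by (simp add: ac_simps)
    then have "segment x (i + m * d) (length u) = segment x i (length u)"
      by (simp add: segment_eq_iff)
    then show ?thesis using assms(2) by (simp add: occurrences_def)
  qed
  have "sublist u (segment x p (i + d + length u))" for p
  proof -
    \<comment> \<open>Rounding \<open>p\<close> up to a multiple of \<open>d\<close> costs at most
      \<open>d\<close>; the shift \<open>i\<close> and the word itself account for the rest of the
      window.\<close>
    have "p \<le> (p div d + 1) * d" "(p div d + 1) * d \<le> p + d"
      using d(1) dividend_less_div_times[of d p] by (auto simp: algebra_simps less_imp_le)
    then show ?thesis
      unfolding sublist_segment_iff
      by (intro exI[of _ "i + (p div d + 1) * d"] conjI occ) linarith+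
  qed
  then show ?thesis by blast
qed

lemma toeplitz_imp_generalized_almost_periodic:
  assumes "toeplitz x"
  shows "generalized_almost_periodic x"
  unfolding generalized_almost_periodic_def
  using toeplitz_word_recurs[OF assms] by (metis ex_in_conv finite.emptyI)

text \<open>A finite range leaves finitely many words of length \<open>n\<close>, and the sum of
  their individual window lengths works for all of them.\<close>

lemma toeplitz_words_recur_uniformly:
  assumes "toeplitz x" "finite (range x)"
  shows "\<exists>l. \<forall>u p. length u = n \<longrightarrow> occurrences u x \<noteq> {} \<longrightarrow> sublist u (segment x p l)"
proof -
  define W where "W = {u. length u = n \<and> occurrences u x \<noteq> {}}"
  have "W \<subseteq> {u. set u \<subseteq> range x \<and> length u = n}"
  proof
    fix u assume "u \<in> W"
    then obtain i where "segment x i (length u) = u" "length u = n"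
      by (auto simp: W_def occurrences_def)
    moreover have "set (segment x i (length u)) \<subseteq> range x" by (auto simp: segment_def)
    ultimately show "u \<in> {u. set u \<subseteq> range x \<and> length u = n}" by simp
  qed
  then have fin: "finite W"
    using finite_lists_length_eq[OF assms(2)] finite_subset by blast
  have "\<forall>u\<in>W. \<exists>l. \<forall>p. sublist u (segment x p l)"
    using toeplitz_word_recurs[OF assms(1)] by (auto simp: W_def)
  then obtain L where L: "\<And>u p. u \<in> W \<Longrightarrow> sublist u (segment x p (L u))"
    unfolding bchoice_iff by auto
  have "sublist u (segment x p (sum L W))" if "u \<in> W" for u p
  proof -
    have "L u \<le> sum L W" using that fin by (intro member_le_sum) auto
    then show ?thesis using L[OF that, of p] unfolding sublist_segment_iff
      by (meson add_le_cancel_left le_trans)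
  qed
  then show ?thesis unfolding W_def by blast
qed

text \<open>A short segment of \<open>y\<close> either lies inside one copy of the repeated block or
  runs over its end into the first \<open>N\<close> letters; \<open>x\<close> itself repeats those
  letters right after the block, because the block length is one of their common periods.\<close>

lemma toeplitz_periodic_approximation:
  assumes "toeplitz x"
  obtains y where "periodic y" "\<And>i. i < N \<Longrightarrow> y i = x i" "range y \<subseteq> range x"
    "\<And>p l. l \<le> N \<Longrightarrow> \<exists>q. segment y p l = segment x q l"
proof -
  obtain d where d: "d > 0" "\<And>i m. i < N \<Longrightarrow> x (i + m * d) = x i"
    using toeplitz_common_period[OF assms, of N] by blast
  \<comment> \<open>The factor \<open>Suc N\<close> pushes the length above \<open>N\<close> while
    keeping it a multiple of \<open>d\<close>.\<close>
  define L where "L = Suc N * d"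
  have L: "L > N" "L > 0" using d(1) by (cases d; simp add: L_def)+
  define y where "y i = x (i mod L)" for i
  have "periodic y"
    unfolding periodic_def y_def using L by (intro exI[of _ L]) auto
  moreover have "y i = x i" if "i < N" for i using that L by (simp add: y_def)
  moreover have "range y \<subseteq> range x" by (auto simp: y_def)
  moreover have "segment y p l = segment x (p mod L) l" if "l \<le> N" for p l
    unfolding segment_eq_iff
  proof (intro allI impI)
    fix k assume "k < l"
    have mod: "(p + k) mod L = (p mod L + k) mod L" by (simp add: mod_add_left_eq)
    show "y (p + k) = x (p mod L + k)"
    proof (cases "p mod L + k < L")
      case True
      then show ?thesis by (simp add: y_def mod)
    next
      case False
      \<comment> \<open>\<open>t\<close> is the place reached in the next copy of the block.\<close>
      define t where "t = p mod L + k - L"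
      have t: "p mod L + k = t + L" "t < N"
        using False \<open>k < l\<close> that mod_less_divisor[OF L(2), of p] unfolding t_def by linarith+
      have "y (p + k) = x t" using t L by (simp add: y_def mod)
      also have "\<dots> = x (t + L)" using d(2)[OF t(2), of "Suc N"] by (simp add: L_def)
      finally show ?thesis by (simp add: t)
    qed
  qed
  ultimately show ?thesis by (intro that) blast+
qed

section \<open>Toeplitz sequences outside a countable set\<close>

text \<open>\<open>ruler i\<close> is the exponent of \<open>2\<close> in \<open>i + 1\<close>.\<close>

function ruler :: "nat \<Rightarrow> nat" where
  "ruler i = (if even i then 0 else Suc (ruler (i div 2)))"
  by pat_completeness auto
termination
  by (relation "measure id") (auto elim: oddE)

declare ruler.simps [simp del]

text \<open>Even places have period 2. An odd place inherits twice the period of its half.\<close>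

lemma toeplitz_ruler: "toeplitz ruler"
proof -
  have "\<exists>d>0. \<forall>m. ruler (i + m * d) = ruler i" for i
  proof (induction i rule: ruler.induct)
    case (1 i)
    show ?case
    proof (cases "even i")
      case True
      then show ?thesis by (intro exI[of _ 2]) (simp add: ruler.simps)
    next
      case False
      then obtain d where d: "d > 0" "\<And>m. ruler (i div 2 + m * d) = ruler (i div 2)"
        using 1 by blast
      have "ruler (i + m * (2 * d)) = ruler i" for m
      proof -
        have "(i + m * (2 * d)) div 2 = i div 2 + m * d"
          using div_mult_self1[of 2 i "m * d"] by (simp add: ac_simps)
        then show ?thesis
          using False d(2)[of m] by (simp add: ruler.simps[of i] ruler.simps[of "i + m * (2 * d)"])
      qed
      then show ?thesis using d(1) by (intro exI[of _ "2 * d"]) auto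
    qed
  qed
  then show ?thesis by (simp add: toeplitz_def)
qed

lemma ruler_power_2: "ruler (2 ^ k - 1) = k"
proof (induction k)
  case (Suc k)
  have "(2::nat) ^ Suc k - 1 = 2 * (2 ^ k - 1) + 1"
    by (cases "(2::nat) ^ k") auto
  then show ?case using Suc
    by (simp add: ruler.simps[of "Suc (2 * (2 ^ k - Suc 0))"] del: power_Suc)
qed (simp add: ruler.simps)

lemma toeplitz_compose: "toeplitz x \<Longrightarrow> toeplitz (\<lambda>i. c (x i))"
  unfolding toeplitz_def by metis

text \<open>Recoloring \<open>ruler\<close> by any \<open>c\<close> stays Toeplitz, and the letter
  at place \<open>2 ^ k - 1\<close> is \<open>c k\<close>, which can be chosen to differ from the
  \<open>k\<close>-th member of \<open>M\<close> there.\<close>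

lemma ex_toeplitz_outside_countable:
  assumes "countable M" "a \<noteq> b"
  shows "\<exists>x. toeplitz x \<and> range x \<subseteq> {a, b} \<and> x \<notin> M"
proof -
  define e where "e = from_nat_into M"
  define c where "c k = (if e k (2 ^ k - 1) = a then b else a)" for k
  let ?x = "\<lambda>i. c (ruler i)"
  have "?x \<notin> M"
  proof
    assume "?x \<in> M"
    then obtain k where "e k = ?x"
      using from_nat_into_surj[OF assms(1)] unfolding e_def by metis
    then have "e k (2 ^ k - 1) = c k" by (simp only: ruler_power_2)
    then show False using assms(2) by (auto simp: c_def split: if_splits)
  qed
  moreover have "range ?x \<subseteq> {a, b}" by (auto simp: c_def)
  ultimately show ?thesis using toeplitz_compose[OF toeplitz_ruler] by blast
qed

section \<open>Undecidability of membership\<close>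

theorem theorem27:
  fixes A :: "nat set" and M :: "(nat \<Rightarrow> nat) set"
  assumes "\<exists>a\<in>A. \<exists>b\<in>A. a \<noteq> b"
    and "M \<subseteq> sequences A"
    and "countable M"
    and "\<forall>x\<in>sequences A. periodic x \<longrightarrow> x \<in> M"
  shows "\<not> (\<exists>p. decides_membership A p M)"
proof
  assume "\<exists>p. decides_membership A p M"
  then obtain p where p: "\<And>x f. x \<in> sequences A \<Longrightarrow> generalized_almost_periodic x \<Longrightarrow>
      (\<And>n. regulator x n \<le> f n) \<Longrightarrow> computes x f p [] (if x \<in> M then 1 else 0)"
    by (auto simp: decides_membership_def)
  obtain a b where ab: "a \<in> A" "b \<in> A" "a \<noteq> b" using assms(1) by blast
  have seq: "x \<in> sequences A" if "range x \<subseteq> {a, b}" for x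
    unfolding sequences_def using that ab by (auto intro!: exI[of _ "{a, b}"])
  obtain x where x: "toeplitz x" "range x \<subseteq> {a, b}" "x \<notin> M"
    using ex_toeplitz_outside_countable[OF assms(3) ab(3)] by blast
  have "finite (range x)" using x(2) finite_subset by blast
  then obtain f where f: "\<And>n u q. length u = n \<Longrightarrow> occurrences u x \<noteq> {} \<Longrightarrow>
      sublist u (segment x q (f n))"
    using toeplitz_words_recur_uniformly[OF x(1)] by metis
  have "regulator x n \<le> f n" for n by (intro regulator_le f)
  then have "computes x f p [] 0"
    using p[of x f] x seq toeplitz_imp_generalized_almost_periodic[OF x(1)] by simp
  then obtain N where N: "\<And>y g. (\<forall>i<N. y i = x i \<and> g i = f i) \<Longrightarrow> computes y g p [] 0"
    using computes_continuous by blast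
  \<comment> \<open>For \<open>n < N\<close>, both words of length \<open>n\<close> and windows of
    length \<open>f n\<close> in \<open>y\<close> must be found in \<open>x\<close>, so
    \<open>N'\<close> has to exceed or equal \<open>N\<close> and all these
    \<open>f n\<close>.\<close>
  define N' where "N' = N + sum f {..<N}"
  obtain y where y: "periodic y" "\<And>i. i < N' \<Longrightarrow> y i = x i" "range y \<subseteq> range x"
    "\<And>q l. l \<le> N' \<Longrightarrow> \<exists>r. segment y q l = segment x r l"
    using toeplitz_periodic_approximation[OF x(1), of N'] by metis
  have reg: "regulator y n \<le> f n" if "n < N" for n
  proof (rule regulator_le)
    fix u :: "nat list" and q assume u: "length u = n" "occurrences u y \<noteq> {}"
    have "n \<le> N'" "f n \<le> N'"
      using that member_le_sum[of n "{..<N}" f] by (auto simp: N'_def)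
    obtain i where "segment y i n = u" using u by (auto simp: occurrences_def)
    then have "occurrences u x \<noteq> {}"
      using u(1) y(4)[OF \<open>n \<le> N'\<close>, of i] by (auto simp: occurrences_def)
    then show "sublist u (segment y q (f n))"
      using f u(1) y(4)[OF \<open>f n \<le> N'\<close>, of q] by metis
  qed
  \<comment> \<open>Below \<open>N\<close> the computation may read \<open>g\<close>, so it copies
    \<open>f\<close>; beyond, any bound on the regulator of \<open>y\<close> will do.\<close>
  define g where "g n = (if n < N then f n else regulator y n)" for n
  have "y \<in> sequences A" using seq y(3) x(2) by blast
  moreover have "y \<in> M" using assms(4) y(1) calculation by blast
  ultimately have "computes y g p [] 1"
    using p[of y g] reg toeplitz_imp_generalized_almost_periodic[OF periodic_imp_toeplitz[OF y(1)]]
    by (simp add: g_def)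
  moreover have "computes y g p [] 0"
    using y(2) by (intro N) (simp add: g_def N'_def)
  ultimately show False using computes_deterministic by fastforce
qed

end
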